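(* Let $X\neq\{0\}$ be a real Hilbert space and let $C\subseteq X$ be a bounded, convex and closed set having $0$ in its interior. Then $C^{\circ}$ is also bounded, convex and closed with $0$ in its interior, and $\mathscr{M}_C^{\circ}=\mathscr{M}_{C^{\circ}}$.
   Context: For $\emptyset\neq C\subseteq X$: the polar set is $C^{\circ}:=\{x^*\in X:\langle x^*,c\rangle\leq 1\ \ \forall c\in C\}$; the gauge (Minkowski functional) is $\mathscr{M}_C:X\to[0,\infty]$, $\mathscr{M}_C(x):=\inf\{\mu\geq 0: x\in\mu C\}$, where $\mu C=\{\mu c:c\in C\}$ and $\inf\emptyset:=\infty$. If $C$ is bounded, convex, closed and has $0$ in its interior (so that $0<\mathscr{M}_C(x)<\infty$ for $x\neq 0$), the polar of $\mathscr{M}_C$ is the function $\mathscr{M}_C^{\circ}:X\to[0,\infty]$, $\mathscr{M}_C^{\circ}(x^* ):=\sup\left\{\frac{\langle x^*,x\rangle}{\mathscr{M}_C(x)}:0\neq x\in X\right\}$. *)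

theory Defs
  imports "HOL-Analysis.Analysis"
begin

definition polar_set :: "'a::real_inner set \<Rightarrow> 'a set" where
  "polar_set C = {y. \<forall>c\<in>C. y \<bullet> c \<le> 1}"

text \<open>Values in \<open>[0,\<infinity>]\<close> are represented in \<^typ>\<open>ereal\<close>, where the infimum of the empty set is \<open>\<infinity>\<close>.\<close>

definition minkowski_functional :: "'a::real_vector set \<Rightarrow> 'a \<Rightarrow> ereal" where
  "minkowski_functional C x = Inf {ereal \<mu> | \<mu>. \<mu> \<ge> 0 \<and> x \<in> (\<lambda>c. \<mu> *\<^sub>R c) ` C}"

text \<open>Intended for functions with \<open>0 < f x < \<infinity>\<close> for all \<open>x \<noteq> 0\<close> on a space other than \<open>{0}\<close>,
  so that no quotient is degenerate and the supremum is over a nonempty set. The extended reals are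
  needed here (rather than nonnegative ones) because individual quotients may be negative.\<close>

definition polar_function :: "('a::real_inner \<Rightarrow> ereal) \<Rightarrow> 'a \<Rightarrow> ereal" where
  "polar_function f y = Sup {ereal (y \<bullet> x) / f x | x. x \<noteq> 0}"

end

theory Submission
  imports Defs
begin

text \<open>
  Both functions in the claimed identity equal the support function
  \<open>y \<mapsto> SUP c\<in>C. \<langle>y, c\<rangle>\<close> of \<open>C\<close>.

  For the gauge of the polar set, a number \<open>\<mu> > 0\<close> satisfies \<open>y \<in> \<mu> C\<degree>\<close> precisely when
  \<open>\<mu>\<close> is an upper bound of \<open>\<langle>y, c\<rangle>\<close> over \<open>c \<in> C\<close>, so the infimum of these \<open>\<mu>\<close> is the least upper bound
  (\<open>minkowski_functional_polar_set\<close>).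

  For the polar of the gauge, every \<open>c \<in> C\<close> has gauge at most \<open>1\<close>, so for \<open>c \<noteq> 0\<close> dividing a nonnegative
  \<open>\<langle>y, c\<rangle>\<close> by the gauge can only increase it. Conversely, if \<open>x = \<mu> c\<close> then
  \<open>\<langle>y, x\<rangle> / \<mu> = \<langle>y, c\<rangle>\<close>, and letting \<open>\<mu>\<close> decrease to the gauge of \<open>x\<close> bounds every quotient
  by the support function (\<open>polar_function_minkowski_functional\<close>).

  The topological properties come from duality of balls: the polar set is an intersection of closed
  half-spaces, and taking polars reverses inclusions and inverts radii, so that a ball inside \<open>C\<close>
  bounds \<open>C\<degree>\<close>, and a ball around \<open>C\<close> yields one inside \<open>C\<degree>\<close>.
\<close>

lemma polar_set_eq_Inter_halfspaces: "polar_set C = (\<Inter>c\<in>C. {y. c \<bullet> y \<le> 1})"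
  by (auto simp: polar_set_def inner_commute)

lemma convex_polar_set: "convex (polar_set C)"
  unfolding polar_set_eq_Inter_halfspaces by (intro convex_INT convex_halfspace_le)

lemma closed_polar_set: "closed (polar_set C)"
  unfolding polar_set_eq_Inter_halfspaces by (intro closed_INT ballI closed_halfspace_le)

text \<open>Testing \<open>y \<in> C\<degree>\<close> against the vector of length \<open>e\<close> in the direction of \<open>y\<close> gives
  \<open>e \<parallel>y\<parallel> \<le> 1\<close>.\<close>

lemma bounded_polar_set:
  assumes "0 \<in> interior C"
  shows "bounded (polar_set C)"
proof -
  obtain e where e: "e > 0" "cball 0 e \<subseteq> C"
    using assms by (auto simp: mem_interior_cball)
  have "norm y \<le> 1 / e" if y: "y \<in> polar_set C" for y
  proof (cases "y = 0")
    case False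
    have "(e / norm y) *\<^sub>R y \<in> C"
      using e False by (intro subsetD[OF e(2)]) simp
    then have "y \<bullet> ((e / norm y) *\<^sub>R y) \<le> 1"
      using y by (auto simp: polar_set_def)
    then have "e * norm y \<le> 1"
      using False by (simp add: power2_norm_eq_inner[symmetric] power2_eq_square)
    then show ?thesis
      using e by (simp add: field_simps)
  qed (use e in simp)
  then show ?thesis
    by (auto simp: bounded_iff)
qed

text \<open>If \<open>C\<close> lies in the ball of radius \<open>B\<close>, the Cauchy-Schwarz inequality puts the ball of
  radius \<open>1 / B\<close> inside \<open>C\<degree>\<close>.\<close>

lemma zero_in_interior_polar_set:
  assumes "bounded C"
  shows "0 \<in> interior (polar_set C)"
proof -
  obtain B where B: "B > 0" "\<And>c. c \<in> C \<Longrightarrow> norm c \<le> B"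
    using assms by (auto simp: bounded_pos)
  have "y \<bullet> c \<le> 1" if "norm y \<le> 1 / B" "c \<in> C" for y c
  proof -
    have "y \<bullet> c \<le> norm y * norm c"
      by (rule norm_cauchy_schwarz)
    also have "\<dots> \<le> (1 / B) * B"
      using that B by (intro mult_mono) auto
    finally show ?thesis
      using B by simp
  qed
  then have "cball 0 (1 / B) \<subseteq> polar_set C"
    by (auto simp: polar_set_def)
  then show ?thesis
    using B(1) by (auto simp: mem_interior_cball intro!: exI[of _ "1 / B"])
qed

text \<open>The scalars \<open>\<mu> > 0\<close> with \<open>y \<in> \<mu> C\<degree>\<close> are the positive upper bounds of \<open>\<langle>y, _\<rangle>\<close> on \<open>C\<close>.
  If \<open>\<langle>y, _\<rangle>\<close> has maximum \<open>0\<close> on \<open>C\<close>, the bound \<open>0\<close> itself need not occur among these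
  scalars, but it is still their infimum; hence the upper estimate is made with numbers strictly
  above the supremum.\<close>

lemma minkowski_functional_polar_set:
  assumes "0 \<in> C"
  shows "minkowski_functional (polar_set C) y = (SUP c\<in>C. ereal (y \<bullet> c))"
proof (rule antisym)
  show "minkowski_functional (polar_set C) y \<le> (SUP c\<in>C. ereal (y \<bullet> c))"
  proof (rule ereal_le_real)
    fix r :: real
    assume "(SUP c\<in>C. ereal (y \<bullet> c)) \<le> ereal r"
    then have bound: "y \<bullet> c \<le> r" if "c \<in> C" for c
      using that by (auto simp: SUP_le_iff)
    have "0 \<le> r"
      using bound[OF assms] by simp
    show "minkowski_functional (polar_set C) y \<le> ereal r"
    proof (rule ereal_le_epsilon2)
      fix e :: real
      assume "0 < e"
      define \<mu> where "\<mu> = r + e"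
      have "\<mu> > 0" "r \<le> \<mu>"
        using \<open>0 < e\<close> \<open>0 \<le> r\<close> by (auto simp: \<mu>_def)
      have "(1 / \<mu>) *\<^sub>R y \<in> polar_set C"
        using bound \<open>\<mu> > 0\<close> \<open>r \<le> \<mu>\<close> by (fastforce simp: polar_set_def)
      moreover have "y = \<mu> *\<^sub>R ((1 / \<mu>) *\<^sub>R y)"
        using \<open>\<mu> > 0\<close> by simp
      ultimately have "y \<in> (\<lambda>c. \<mu> *\<^sub>R c) ` polar_set C"
        by blast
      then have "minkowski_functional (polar_set C) y \<le> ereal \<mu>"
        unfolding minkowski_functional_def using \<open>\<mu> > 0\<close> by (intro Inf_lower) auto
      then show "minkowski_functional (polar_set C) y \<le> ereal r + ereal e"
        by (simp add: \<mu>_def)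
    qed
  qed
next
  have "y \<bullet> c \<le> \<mu>" if "\<mu> \<ge> 0" "y = \<mu> *\<^sub>R z" "z \<in> polar_set C" "c \<in> C" for \<mu> z c
    using that mult_left_mono[of "z \<bullet> c" 1 \<mu>] by (auto simp: polar_set_def)
  then show "(SUP c\<in>C. ereal (y \<bullet> c)) \<le> minkowski_functional (polar_set C) y"
    unfolding minkowski_functional_def by (intro Inf_greatest SUP_least) auto
qed

lemma minkowski_functional_le_1:
  assumes "c \<in> C"
  shows "minkowski_functional C c \<le> 1"
  unfolding minkowski_functional_def
  using assms by (intro Inf_lower) (auto simp: one_ereal_def intro!: exI[of _ 1])

text \<open>The gauge lies between multiples of the norm: boundedness of \<open>C\<close> keeps it away from \<open>0\<close>,
  and a ball inside \<open>C\<close> keeps it finite. Its quotients are therefore quotients of real numbers.\<close>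

lemma minkowski_functional_positive_real:
  fixes C :: "'a::real_normed_vector set"
  assumes "bounded C" and "0 \<in> interior C" and "x \<noteq> 0"
  obtains m where "m > 0" and "minkowski_functional C x = ereal m"
proof -
  obtain B where B: "B > 0" "\<And>c. c \<in> C \<Longrightarrow> norm c \<le> B"
    using assms(1) by (auto simp: bounded_pos)
  obtain e where e: "e > 0" "cball 0 e \<subseteq> C"
    using assms(2) by (auto simp: mem_interior_cball)
  have "norm x / B \<le> \<mu>" if "\<mu> \<ge> 0" "x = \<mu> *\<^sub>R c" "c \<in> C" for \<mu> c
    using that B mult_left_mono[of "norm c" B \<mu>] by (auto simp: field_simps)
  then have lower: "ereal (norm x / B) \<le> minkowski_functional C x"
    unfolding minkowski_functional_def by (intro Inf_greatest) auto
  have "(e / norm x) *\<^sub>R x \<in> C"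
    using e assms(3) by (intro subsetD[OF e(2)]) simp
  moreover have "x = (norm x / e) *\<^sub>R ((e / norm x) *\<^sub>R x)"
    using e assms(3) by simp
  ultimately have "x \<in> (\<lambda>c. (norm x / e) *\<^sub>R c) ` C"
    by blast
  then have upper: "minkowski_functional C x \<le> ereal (norm x / e)"
    unfolding minkowski_functional_def using e by (intro Inf_lower) auto
  have "norm x / B > 0"
    using B assms(3) by simp
  with lower upper that show thesis
    by (cases "minkowski_functional C x") auto
qed

text \<open>This passes from \<open>\<langle>y, x\<rangle> \<le> \<mu> r\<close> for all \<open>\<mu>\<close> with \<open>x \<in> \<mu> C\<close> to the infimum of those \<open>\<mu>\<close>,
  which need not be attained.\<close>

lemma inner_le_minkowski_functional_times_bound:
  assumes m: "minkowski_functional C x = ereal m"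
    and bound: "\<And>c. c \<in> C \<Longrightarrow> y \<bullet> c \<le> r" and "r \<ge> 0"
  shows "y \<bullet> x \<le> m * r"
proof -
  have le: "y \<bullet> x \<le> \<mu> * r" if "\<mu> \<ge> 0" "x = \<mu> *\<^sub>R c" "c \<in> C" for \<mu> c
    using that bound by (simp add: mult_left_mono)
  show ?thesis
  proof (cases "r = 0")
    case True
    (* The gauge is finite, so some \<mu> with x in \<mu>C exists. *)
    have "{ereal \<mu> | \<mu>. \<mu> \<ge> 0 \<and> x \<in> (\<lambda>c. \<mu> *\<^sub>R c) ` C} \<noteq> {}"
      using m unfolding minkowski_functional_def
      by (metis Inf_empty PInfty_neq_ereal(1) top_ereal_def)
    then show ?thesis
      using True le by fastforce
  next
    case False
    then have "y \<bullet> x / r \<le> \<mu>" if "\<mu> \<ge> 0" "x = \<mu> *\<^sub>R c" "c \<in> C" for \<mu> c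
      using le[OF that] \<open>r \<ge> 0\<close> by (simp add: field_simps)
    then have "ereal (y \<bullet> x / r) \<le> minkowski_functional C x"
      unfolding minkowski_functional_def by (intro Inf_greatest) auto
    then show ?thesis
      using m False \<open>r \<ge> 0\<close> by (simp add: field_simps)
  qed
qed

lemma polar_function_minkowski_functional:
  fixes C :: "'a::real_inner set"
  assumes nontrivial: "(UNIV :: 'a set) \<noteq> {0}"
    and "bounded C" and "0 \<in> interior C"
  shows "polar_function (minkowski_functional C) y = (SUP c\<in>C. ereal (y \<bullet> c))"
proof (rule antisym)
  have "0 \<in> C"
    using assms(3) interior_subset by blast
  show "polar_function (minkowski_functional C) y \<le> (SUP c\<in>C. ereal (y \<bullet> c))"
    unfolding polar_function_def
  proof (rule Sup_least, clarify)
    fix x :: 'a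
    assume "x \<noteq> 0"
    then obtain m where m: "m > 0" "minkowski_functional C x = ereal m"
      using minkowski_functional_positive_real[OF assms(2,3)] by blast
    show "ereal (y \<bullet> x) / minkowski_functional C x \<le> (SUP c\<in>C. ereal (y \<bullet> c))"
    proof (rule ereal_le_real)
      fix r :: real
      assume "(SUP c\<in>C. ereal (y \<bullet> c)) \<le> ereal r"
      then have bound: "y \<bullet> c \<le> r" if "c \<in> C" for c
        using that by (auto simp: SUP_le_iff)
      then have "y \<bullet> x \<le> m * r"
        using inner_le_minkowski_functional_times_bound[OF m(2)] bound[OF \<open>0 \<in> C\<close>] by simp
      then show "ereal (y \<bullet> x) / minkowski_functional C x \<le> ereal r"
        using m by (simp add: field_simps)
    qed
  qed
next
  let ?P = "polar_function (minkowski_functional C) y"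
  have quotient_le: "ereal (y \<bullet> x / m) \<le> ?P"
    if "x \<noteq> 0" "m > 0" "minkowski_functional C x = ereal m" for x m
  proof -
    have "ereal (y \<bullet> x) / minkowski_functional C x \<le> ?P"
      unfolding polar_function_def using that(1) by (intro Sup_upper) blast
    then show ?thesis
      using that by simp
  qed
  (* Of two opposite nonzero vectors, one has a nonnegative inner product with y. *)
  have "0 \<le> ?P"
  proof -
    obtain v :: 'a where "v \<noteq> 0"
      using nontrivial by blast
    then obtain x where x: "x \<noteq> 0" "0 \<le> y \<bullet> x"
      by (metis inner_minus_right linear neg_0_le_iff_le neg_equal_0_iff_equal)
    obtain m where m: "m > 0" "minkowski_functional C x = ereal m"
      using minkowski_functional_positive_real[OF assms(2,3) x(1)] by blast
    have "0 \<le> ereal (y \<bullet> x / m)"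
      using x m by simp
    also have "\<dots> \<le> ?P"
      using quotient_le x m by blast
    finally show ?thesis .
  qed
  show "(SUP c\<in>C. ereal (y \<bullet> c)) \<le> ?P"
  proof (rule SUP_least)
    fix c
    assume "c \<in> C"
    show "ereal (y \<bullet> c) \<le> ?P"
    proof (cases "y \<bullet> c \<le> 0")
      case True
      then have "ereal (y \<bullet> c) \<le> 0"
        by simp
      then show ?thesis
        using \<open>0 \<le> ?P\<close> by (rule order_trans)
    next
      case False
      then have "c \<noteq> 0"
        by auto
      then obtain m where m: "m > 0" "minkowski_functional C c = ereal m"
        using minkowski_functional_positive_real[OF assms(2,3)] by blast
      have "m \<le> 1"
        using minkowski_functional_le_1[OF \<open>c \<in> C\<close>] m by simp
      then have "y \<bullet> c \<le> y \<bullet> c / m"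
        using False m mult_left_mono[of m 1 "y \<bullet> c"] by (simp add: field_simps)
      then have "ereal (y \<bullet> c) \<le> ereal (y \<bullet> c / m)"
        by simp
      also have "\<dots> \<le> ?P"
        using quotient_le \<open>c \<noteq> 0\<close> m by blast
      finally show ?thesis .
    qed
  qed
qed

theorem lemma3p2:
  fixes C :: "'a::{real_inner, complete_space} set"
  assumes "(UNIV :: 'a set) \<noteq> {0}"
    and "bounded C" and "convex C" and "closed C" and "0 \<in> interior C"
  shows "bounded (polar_set C) \<and> convex (polar_set C) \<and> closed (polar_set C) \<and>
         0 \<in> interior (polar_set C) \<and>
         polar_function (minkowski_functional C) = minkowski_functional (polar_set C)"
proof -
  have "0 \<in> C"
    using assms(5) interior_subset by blast
  have "polar_function (minkowski_functional C) = minkowski_functional (polar_set C)"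
    using polar_function_minkowski_functional[OF assms(1,2,5)]
      minkowski_functional_polar_set[OF \<open>0 \<in> C\<close>]
    by (simp add: fun_eq_iff)
  then show ?thesis
    using bounded_polar_set[OF assms(5)] convex_polar_set closed_polar_set
      zero_in_interior_polar_set[OF assms(2)] by blast
qed

end
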